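(* Let $s,k$ be integers with $s\ge 2k\ge 4$. If $H\in\mathfrak{C}_{2s-1}^{4k-4}$, then $\delta_{\mathrm{B}}(H)\ge\frac{1}{2k}$.
   Context: All graphs are finite and simple; $\delta(G)$ is the minimum degree of $G$. A graph $G$ is $H$-free if it contains no (not necessarily induced) subgraph isomorphic to $H$; it is maximal $H$-free if it is $H$-free and adding any missing edge on the same vertex set creates a copy of $H$. A blowup of a graph $F$ is obtained by replacing every vertex of $F$ by an independent set (possibly empty), called a part, and every edge of $F$ by a complete bipartite graph between the corresponding parts, with no other edges; $G=F[\cdot]$ means that $G$ is some blowup of $F$. The blowup threshold of $H$ is $$\delta_{\mathrm{B}}(H):=\inf\{\alpha\ge 0:\ \exists\,F=F(\alpha,H)\text{ such that every maximal }H\text{-free graph }G\text{ with }\delta(G)\ge\alpha|V(G)|\text{ satisfies }G=F[\cdot]\},$$ where $F$ is a (finite) graph. $C_m$ denotes the cycle of length $m$. For integers $m\ge 3$ and $0\le\ell\le m$, $\mathfrak{C}_m^{\ell}$ denotes the family of blowups of $C_m$ having a singleton interval of length exactly $\ell$, that is, $\ell$ consecutive parts (in the cyclic order of $C_m$) have size exactly $1$, and all the remaining $m-\ell$ parts have size at least $2$. *)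

theory Defs
  imports Complex_Main "HOL-Library.Disjoint_Sets"
begin

record 'a ugraph =
  verts :: "'a set"
  edges :: "'a set set"

definition simple_graph :: "'a ugraph \<Rightarrow> bool" where
  "simple_graph G \<longleftrightarrow> finite (verts G) \<and> (\<forall>e\<in>edges G. e \<subseteq> verts G \<and> card e = 2)"

definition degree :: "'a ugraph \<Rightarrow> 'a \<Rightarrow> nat" where
  "degree G v = card {e \<in> edges G. v \<in> e}"

text \<open>The value \<open>0\<close> for the graph without vertices is a convention; it is immaterial below, because
  that graph is a blowup of every graph.\<close>
definition min_degree :: "'a ugraph \<Rightarrow> nat" where
  "min_degree G = (if verts G = {} then 0 else Min (degree G ` verts G))"

definition subgraph :: "'a ugraph \<Rightarrow> 'a ugraph \<Rightarrow> bool" where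
  "subgraph K G \<longleftrightarrow> simple_graph K \<and> verts K \<subseteq> verts G \<and> edges K \<subseteq> edges G"

definition graph_iso :: "'a ugraph \<Rightarrow> 'b ugraph \<Rightarrow> bool" where
  "graph_iso H K \<longleftrightarrow>
     (\<exists>f. bij_betw f (verts H) (verts K) \<and> edges K = (\<lambda>e. f ` e) ` edges H)"

definition contains_copy :: "'a ugraph \<Rightarrow> 'b ugraph \<Rightarrow> bool" where
  "contains_copy G H \<longleftrightarrow> (\<exists>K. subgraph K G \<and> graph_iso H K)"

definition add_edge :: "'a \<Rightarrow> 'a \<Rightarrow> 'a ugraph \<Rightarrow> 'a ugraph" where
  "add_edge u v G = G\<lparr>edges := insert {u, v} (edges G)\<rparr>"

definition maximal_free :: "'b ugraph \<Rightarrow> 'a ugraph \<Rightarrow> bool" where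
  "maximal_free H G \<longleftrightarrow> simple_graph G \<and> \<not> contains_copy G H \<and>
     (\<forall>u\<in>verts G. \<forall>v\<in>verts G. u \<noteq> v \<and> {u, v} \<notin> edges G \<longrightarrow>
        contains_copy (add_edge u v G) H)"

text \<open>\<open>P x\<close> is the part replacing the vertex \<open>x\<close> of \<open>F\<close>. Since \<open>F\<close> has no loops and the parts are
  disjoint, the equation for \<open>edges G\<close> makes every part independent.\<close>
definition blowup_with :: "'b ugraph \<Rightarrow> ('b \<Rightarrow> 'a set) \<Rightarrow> 'a ugraph \<Rightarrow> bool" where
  "blowup_with F P G \<longleftrightarrow>
     verts G = (\<Union>x\<in>verts F. P x) \<and> disjoint_family_on P (verts F) \<and>
     edges G = {{u, v} | u v x y. {x, y} \<in> edges F \<and> u \<in> P x \<and> v \<in> P y}"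

definition is_blowup :: "'b ugraph \<Rightarrow> 'a ugraph \<Rightarrow> bool" where
  "is_blowup F G \<longleftrightarrow> (\<exists>P. blowup_with F P G)"

text \<open>Every finite graph is isomorphic to one with vertices in \<^typ>\<open>nat\<close>, and all notions involved
  are invariant under isomorphism, so \<open>F\<close> and \<open>G\<close> range over all finite simple graphs.\<close>
definition blowup_admissible :: "'b ugraph \<Rightarrow> real \<Rightarrow> bool" where
  "blowup_admissible H \<alpha> \<longleftrightarrow>
     (\<exists>F :: nat ugraph. simple_graph F \<and>
        (\<forall>G :: nat ugraph. maximal_free H G \<and> real (min_degree G) \<ge> \<alpha> * real (card (verts G))
           \<longrightarrow> is_blowup F G))"

definition blowup_threshold :: "'b ugraph \<Rightarrow> real" where
  "blowup_threshold H = Inf {\<alpha>. \<alpha> \<ge> 0 \<and> blowup_admissible H \<alpha>}"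

definition cycle_graph :: "nat \<Rightarrow> nat ugraph" where
  "cycle_graph m = \<lparr>verts = {..<m}, edges = {{i, Suc i mod m} | i. i < m}\<rparr>"

definition cycle_blowups :: "nat \<Rightarrow> nat \<Rightarrow> 'a ugraph set" where
  "cycle_blowups m l = {H. simple_graph H \<and>
     (\<exists>P a. blowup_with (cycle_graph m) P H \<and>
        (\<forall>j<l. card (P ((a + j) mod m)) = 1) \<and>
        (\<forall>j. l \<le> j \<and> j < m \<longrightarrow> card (P ((a + j) mod m)) \<ge> 2))}"

lemma degree_less_card_verts:
  assumes "simple_graph G" "v \<in> verts G"
  shows "degree G v < card (verts G)"
proof -
  have fin: "finite (verts G)" using assms by (simp add: simple_graph_def)
  have "{e \<in> edges G. v \<in> e} \<subseteq> (\<lambda>w. {v, w}) ` (verts G - {v})"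
  proof
    fix e assume "e \<in> {e \<in> edges G. v \<in> e}"
    then have e: "v \<in> e" "card e = 2" "e \<subseteq> verts G"
      using assms(1) by (auto simp: simple_graph_def)
    then obtain w where "e = {v, w}" "w \<noteq> v" by (auto simp: card_2_iff)
    with e show "e \<in> (\<lambda>w. {v, w}) ` (verts G - {v})" by blast
  qed
  then have "degree G v \<le> card ((\<lambda>w. {v, w}) ` (verts G - {v}))"
    unfolding degree_def using fin by (intro card_mono) auto
  also have "\<dots> \<le> card (verts G - {v})" using fin by (intro card_image_le) auto
  also have "\<dots> < card (verts G)" using fin assms(2) by (intro psubset_card_mono) auto
  finally show ?thesis .
qed

text \<open>The set in the definition of the threshold is nonempty (and bounded below by \<open>0\<close>), so its real
  \<^const>\<open>Inf\<close> is the actual infimum.\<close>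
lemma blowup_admissible_one: "blowup_admissible H 1"
  unfolding blowup_admissible_def
proof (intro exI[of _ "\<lparr>verts = {}, edges = {}\<rparr>"] conjI allI impI)
  show "simple_graph (\<lparr>verts = {}, edges = {}\<rparr> :: nat ugraph)" by (simp add: simple_graph_def)
next
  fix G :: "nat ugraph"
  assume G: "maximal_free H G \<and> real (min_degree G) \<ge> 1 * real (card (verts G))"
  then have sg: "simple_graph G" by (simp add: maximal_free_def)
  have "verts G = {}"
  proof (rule ccontr)
    assume ne: "verts G \<noteq> {}"
    then obtain v where v: "v \<in> verts G" by blast
    have "min_degree G \<le> degree G v"
      using v sg by (auto simp: min_degree_def simple_graph_def)
    with degree_less_card_verts[OF sg v] G show False by simp
  qed
  moreover from this have "edges G = {}" using sg by (force simp: simple_graph_def)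
  ultimately show "is_blowup \<lparr>verts = {}, edges = {}\<rparr> G"
    by (simp add: is_blowup_def blowup_with_def disjoint_family_on_def)
qed

end

theory Submission
  imports Defs "HOL-Library.Nat_Bijection"
begin

text \<open>
  For \<open>\<alpha> < 1 / (2 * k)\<close> and any finite graph \<open>F\<close> there is a maximal \<open>H\<close>-free graph of minimum degree at
  least \<open>\<alpha>\<close> times its order that is not a blowup of \<open>F\<close>.  It is an arbitrary maximal \<open>H\<close>-free
  supergraph \<open>G\<close>, on the same vertices, of the following graph \<open>R\<close>.  The vertices of \<open>R\<close> are arranged in levels
  \<open>0, \<dots>, 4 * k - 2\<close>, and edges join cyclically consecutive levels only, so \<open>R\<close> maps
  homomorphically to the odd cycle of length \<open>4 * k - 1\<close>.  From a level congruent to \<open>2\<close> modulo \<open>4\<close> to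
  the next one there is only a matching, whose edges are called links; all other consecutive levels
  are completely joined.  The \<open>2 * k\<close> levels congruent to \<open>0\<close> or \<open>1\<close> modulo \<open>4\<close> have a huge size \<open>n\<close>, the
  others a size \<open>N\<close> depending on \<open>F\<close> and \<open>H\<close> only.  Every vertex is completely joined to some huge
  level, so its degree is at least \<open>n\<close>, while there are at most \<open>2 * k * (n + N)\<close> vertices.

  \<open>R\<close> is \<open>H\<close>-free (\<open>ring_graph_free\<close>): a link lies in no four-cycle, whereas every edge of \<open>H\<close> at a
  part of size at least \<open>2\<close> does.  Removing the links leaves blocks of at most four consecutive
  levels, so in a copy of \<open>H\<close> the large parts, together with the two singletons next to them, lie in
  one block, and these two singletons are at levels with an even difference of absolute value at most
  \<open>2\<close>.  They are also joined by a path of \<open>4 * k - 5\<close> edges through the singletons.  Such a path has an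
  odd displacement, which is too short to go around the ring: a contradiction.

  If \<open>G\<close> were a blowup of \<open>F\<close>, then by the pigeonhole principle many vertices of level \<open>2\<close> would be
  twins in \<open>G\<close> (\<open>blowup_twins\<close>).  Then \<open>G\<close> contains a large complete bipartite graph between levels
  \<open>2\<close> and \<open>3\<close>, and hence a copy of \<open>H\<close> (\<open>copy_if_matching_completed\<close>): the singletons run through the
  levels \<open>5, \<dots>, 4 * k - 2, 0, 1\<close> and the large parts through \<open>2, 3, 4, 3, 4, \<dots>, 3, 4\<close>.
\<close>

section \<open>Copies, maximal free supergraphs and blowups\<close>

lemma contains_copyI:
  assumes H: "simple_graph H" and inj: "inj_on f (verts H)"
    and V: "f ` verts H \<subseteq> verts G" and E: "\<And>e. e \<in> edges H \<Longrightarrow> f ` e \<in> edges G"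
  shows "contains_copy G H"
proof -
  let ?K = "\<lparr>verts = f ` verts H, edges = (\<lambda>e. f ` e) ` edges H\<rparr>"
  have "simple_graph ?K"
    using H inj by (auto simp: simple_graph_def card_image inj_on_subset)
  then have "subgraph ?K G" using V E by (auto simp: subgraph_def)
  moreover have "graph_iso H ?K"
    using inj by (auto simp: graph_iso_def bij_betw_def intro!: exI[of _ f])
  ultimately show ?thesis by (auto simp: contains_copy_def)
qed

lemma contains_copyE:
  assumes "contains_copy G H"
  obtains f where "inj_on f (verts H)" "f ` verts H \<subseteq> verts G"
    "\<forall>e\<in>edges H. f ` e \<in> edges G"
  using assms unfolding contains_copy_def subgraph_def graph_iso_def bij_betw_def
  by (metis image_eqI subset_iff)

lemma maximal_free_supergraph:
  assumes G: "simple_graph G" and free: "\<not> contains_copy G H"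
  obtains G' where "maximal_free H G'" "verts G' = verts G" "edges G \<subseteq> edges G'"
proof -
  define C where "C = {E. edges G \<subseteq> E \<and> simple_graph (G\<lparr>edges := E\<rparr>) \<and> \<not> contains_copy (G\<lparr>edges := E\<rparr>) H}"
  have "C \<subseteq> Pow (Pow (verts G))" by (auto simp: C_def simple_graph_def)
  then have "finite C" using G finite_subset by (fastforce simp: simple_graph_def)
  moreover have "edges G \<in> C" using G free by (simp add: C_def)
  ultimately obtain E where E: "E \<in> C" and max: "\<And>E'. E' \<in> C \<Longrightarrow> E \<subseteq> E' \<Longrightarrow> E' = E"
    by (metis finite_has_maximal2)
  have "maximal_free H (G\<lparr>edges := E\<rparr>)"
    unfolding maximal_free_def
  proof (intro conjI ballI impI)
    fix u v
    assume uv: "u \<in> verts (G\<lparr>edges := E\<rparr>)" "v \<in> verts (G\<lparr>edges := E\<rparr>)"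
      "u \<noteq> v \<and> {u, v} \<notin> edges (G\<lparr>edges := E\<rparr>)"
    have "insert {u, v} E \<notin> C" using max[of "insert {u, v} E"] uv by auto
    then show "contains_copy (add_edge u v (G\<lparr>edges := E\<rparr>)) H"
      using E uv by (auto simp: C_def add_edge_def simple_graph_def)
  qed (use E in \<open>auto simp: C_def\<close>)
  then show ?thesis using that[of "G\<lparr>edges := E\<rparr>"] E by (simp add: C_def)
qed

text \<open>Vertices in the same part of a blowup have the same neighbours.\<close>
lemma blowup_twins:
  assumes bl: "blowup_with F P G" and x: "x \<in> verts F" and F: "simple_graph F"
    and uv: "u \<in> P x" "u' \<in> P x" and e: "{u, w} \<in> edges G"
  shows "{u', w} \<in> edges G"
proof -
  have ed: "edges G = {{u, v} | u v x y. {x, y} \<in> edges F \<and> u \<in> P x \<and> v \<in> P y}"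
    and dj: "disjoint_family_on P (verts F)"
    using bl by (auto simp: blowup_with_def)
  from e ed obtain a b y z where ab: "{u, w} = {a, b}" "{y, z} \<in> edges F" "a \<in> P y" "b \<in> P z"
    by auto
  have yz: "y \<in> verts F" "z \<in> verts F" using F ab(2) by (auto simp: simple_graph_def)
  obtain z' where "{x, z'} \<in> edges F" "w \<in> P z'"
  proof (cases "u = a")
    case True
    then have "x = y" using dj yz x uv ab by (auto simp: disjoint_family_on_def)
    with True ab that show ?thesis by (auto simp: doubleton_eq_iff)
  next
    case False
    then have u: "u = b" "w = a" using ab by (auto simp: doubleton_eq_iff)
    then have "x = z" using dj yz x uv ab by (auto simp: disjoint_family_on_def)
    with u ab that[of y] show ?thesis by (auto simp: insert_commute)
  qed
  then show ?thesis using ed uv by blast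
qed

lemma cycle_blowup_rotate:
  assumes bl: "blowup_with (cycle_graph m) P H" and m: "m > 0"
  shows "blowup_with (cycle_graph m) (\<lambda>j. P ((a + j) mod m)) H"
proof -
  have surj: "\<exists>j<m. i = (a + j) mod m" if "i < m" for i
  proof (intro exI conjI)
    let ?j = "(i + (m - a mod m)) mod m"
    show "?j < m" using m by simp
    have "(a + ?j) mod m = (a mod m + (i + (m - a mod m))) mod m"
      by (simp add: mod_simps)
    also have "a mod m + (i + (m - a mod m)) = i + m"
      using m mod_less_divisor[of m a] by linarith
    finally show "i = (a + ?j) mod m" using that by simp
  qed
  have img: "(\<lambda>j. (a + j) mod m) ` {..<m} = {..<m}" using surj m by auto
  have inj: "inj_on (\<lambda>j. (a + j) mod m) {..<m}" 
    by (rule eq_card_imp_inj_on) (auto simp: img)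
  have dj: "disjoint_family_on P {..<m}" and V: "verts H = (\<Union>i<m. P i)"
    and E: "edges H = {{u, v} | u v x y. {x, y} \<in> edges (cycle_graph m) \<and> u \<in> P x \<and> v \<in> P y}"
    using bl by (auto simp: blowup_with_def cycle_graph_def)
  have ed: "{(a + x) mod m, (a + y) mod m} \<in> edges (cycle_graph m)"
    if "{x, y} \<in> edges (cycle_graph m)" for x y
  proof -
    from that obtain i where i: "i < m" "{x, y} = {i, Suc i mod m}" by (auto simp: cycle_graph_def)
    have "{(a + x) mod m, (a + y) mod m} = (\<lambda>j. (a + j) mod m) ` {x, y}" by simp
    also have "\<dots> = {(a + i) mod m, Suc ((a + i) mod m) mod m}"
      unfolding i(2) by (simp add: mod_simps)
    finally show ?thesis using m by (auto simp: cycle_graph_def)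
  qed
  have ed': "\<exists>x' y'. {x', y'} \<in> edges (cycle_graph m) \<and> x = (a + x') mod m \<and> y = (a + y') mod m"
    if "{x, y} \<in> edges (cycle_graph m)" for x y
  proof -
    from that obtain i where i: "i < m" "{x, y} = {i, Suc i mod m}" by (auto simp: cycle_graph_def)
    obtain j where j: "j < m" "i = (a + j) mod m" using surj i by blast
    have *: "Suc i mod m = (a + Suc j mod m) mod m" using j by (simp add: mod_simps)
    have "{j, Suc j mod m} \<in> edges (cycle_graph m)" using j by (auto simp: cycle_graph_def)
    then show ?thesis using i(2) j(2) * by (metis doubleton_eq_iff)
  qed
  show ?thesis
    unfolding blowup_with_def
  proof (intro conjI)
    have "(\<Union>i<m. P i) = (\<Union>i\<in>(\<lambda>j. (a + j) mod m) ` {..<m}. P i)"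
      by (simp only: img)
    then show "verts H = (\<Union>x\<in>verts (cycle_graph m). P ((a + x) mod m))"
      using V by (simp add: cycle_graph_def)
    show "disjoint_family_on (\<lambda>j. P ((a + j) mod m)) (verts (cycle_graph m))"
      unfolding disjoint_family_on_def
    proof (intro ballI impI)
      fix i j assume ij: "i \<in> verts (cycle_graph m)" "j \<in> verts (cycle_graph m)" "i \<noteq> j"
      then have "(a + i) mod m \<noteq> (a + j) mod m"
        using inj_onD[OF inj, of i j] by (auto simp: cycle_graph_def)
      then show "P ((a + i) mod m) \<inter> P ((a + j) mod m) = {}"
        using disjoint_family_onD[OF dj, of "(a + i) mod m" "(a + j) mod m"] m by simp
    qed
    show "edges H = {{u, v} | u v x y. {x, y} \<in> edges (cycle_graph m) \<and>
        u \<in> P ((a + x) mod m) \<and> v \<in> P ((a + y) mod m)}"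
      unfolding E using ed ed' by blast
  qed
qed

section \<open>A ring of complete bipartite graphs joined by matchings\<close>

text \<open>Natural numbers encode the pairs of a level and an index within that level.\<close>
definition vtx :: "nat \<Rightarrow> nat \<Rightarrow> nat" where
  "vtx l i = prod_encode (l, i)"

definition lev :: "nat \<Rightarrow> nat" where
  "lev v = fst (prod_decode v)"

definition idx :: "nat \<Rightarrow> nat" where
  "idx v = snd (prod_decode v)"

lemma lev_vtx [simp]: "lev (vtx l i) = l" and idx_vtx [simp]: "idx (vtx l i) = i"
  by (simp_all add: lev_def idx_def vtx_def)

lemma vtx_lev_idx [simp]: "vtx (lev v) (idx v) = v"
  by (simp add: lev_def idx_def vtx_def)

lemma vtx_eqI: "lev x = lev y \<Longrightarrow> idx x = idx y \<Longrightarrow> x = y"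
  by (metis vtx_lev_idx)

lemma vtx_inject [simp]: "vtx l i = vtx l' i' \<longleftrightarrow> l = l' \<and> i = i'"
  by (simp add: vtx_def)

text \<open>\<open>y\<close> lies on the level following that of \<open>x\<close> and may be joined to it.  If the level of \<open>x\<close> is
  congruent to \<open>2\<close> modulo \<open>4\<close>, only equal indices are joined; these edges are the links.  In
  particular \<open>4 * k - 2\<close> is such a level, so the ring is closed up by links.\<close>
definition ring_step :: "nat \<Rightarrow> nat \<Rightarrow> nat \<Rightarrow> bool" where
  "ring_step k x y \<longleftrightarrow>
     lev y = Suc (lev x) mod (4 * k - 1) \<and> (lev x mod 4 = 2 \<longrightarrow> idx x = idx y)"

definition level_size :: "nat \<Rightarrow> nat \<Rightarrow> nat \<Rightarrow> nat" where
  "level_size n N l = (if l mod 4 < 2 then n else N)"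

text \<open>The graph \<open>R\<close>: \<open>n\<close> is the size of the huge levels, \<open>N\<close> that of the other levels.\<close>
definition ring_graph :: "nat \<Rightarrow> nat \<Rightarrow> nat \<Rightarrow> nat ugraph" where
  "ring_graph k n N =
     (let V = {v. lev v < 4 * k - 1 \<and> idx v < level_size n N (lev v)}
      in \<lparr>verts = V, edges = {{x, y} | x y. x \<in> V \<and> y \<in> V \<and> ring_step k x y}\<rparr>)"

lemma ring_verts_iff:
  "v \<in> verts (ring_graph k n N) \<longleftrightarrow> lev v < 4 * k - 1 \<and> idx v < level_size n N (lev v)"
  by (simp add: ring_graph_def)

lemma ring_edge_iff:
  "{x, y} \<in> edges (ring_graph k n N) \<longleftrightarrow>
     x \<in> verts (ring_graph k n N) \<and> y \<in> verts (ring_graph k n N) \<and> (ring_step k x y \<or> ring_step k y x)"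
  by (auto simp: ring_graph_def Let_def doubleton_eq_iff)

lemma ring_verts_eq:
  "verts (ring_graph k n N) =
     (\<lambda>(l, i). vtx l i) ` (SIGMA l:{..<4 * k - 1}. {..<level_size n N l})"
  by (force simp: ring_verts_iff image_iff intro: vtx_eqI)

lemma finite_ring_verts: "finite (verts (ring_graph k n N))"
  unfolding ring_verts_eq by (intro finite_imageI finite_SigmaI) auto

lemma card_ring_verts: "card (verts (ring_graph k n N)) \<le> 2 * k * (n + N)"
proof -
  have "card (verts (ring_graph k n N)) \<le> (\<Sum>l<4 * k - 1. level_size n N l)"
    unfolding ring_verts_eq by (rule order.trans[OF card_image_le]) auto
  also have "\<dots> \<le> (\<Sum>l<4 * k. level_size n N l)" by (rule sum_mono2) auto
  also have "\<dots> = 2 * k * (n + N)"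
  proof (induction k)
    case (Suc k)
    have "{..<4 * Suc k} = {4 * k, Suc (4 * k), Suc (Suc (4 * k)), Suc (Suc (Suc (4 * k)))} \<union> {..<4 * k}"
      by auto
    then have "(\<Sum>l<4 * Suc k. level_size n N l) = 2 * (n + N) + (\<Sum>l<4 * k. level_size n N l)"
      by (simp add: level_size_def mod_Suc)
    then show ?case using Suc by (simp add: algebra_simps)
  qed simp
  finally show ?thesis .
qed

lemma simple_ring_graph:
  assumes "k \<ge> 2"
  shows "simple_graph (ring_graph k n N)"
proof -
  have "x \<noteq> y" if "ring_step k x y" "lev x < 4 * k - 1" for x y
    using that assms by (cases "Suc (lev x) < 4 * k - 1") (auto simp: ring_step_def mod_if)
  then show ?thesis
    using finite_ring_verts[of k n N]
    by (auto simp: simple_graph_def ring_graph_def Let_def card_2_iff) blast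
qed

text \<open>Every vertex is joined to all vertices with index below \<open>n\<close> on one of the neighbouring levels.  The
  bound is stated for supergraphs because it is needed for a maximal free one.\<close>
lemma degree_ring_graph:
  assumes k: "k \<ge> 2" and x: "x \<in> verts (ring_graph k n N)"
    and G: "simple_graph G" and sub: "edges (ring_graph k n N) \<subseteq> edges G"
  shows "n \<le> degree G x"
proof -
  define l where "l = (if lev x mod 4 = 0 \<or> lev x mod 4 = 3 then Suc (lev x) else lev x - 1)"
  have xl: "lev x < 4 * k - 1" using x by (simp add: ring_verts_iff)
  have l: "l < 4 * k - 1 \<and> l mod 4 < 2 \<and>
      (l = Suc (lev x) \<and> lev x mod 4 \<noteq> 2 \<or> Suc l = lev x \<and> l mod 4 \<noteq> 2)"
  proof -
    define q where "q = lev x div 4"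
    have "lev x = 4 * q + lev x mod 4" by (simp add: q_def)
    moreover from this have "Suc q \<le> k" using xl by linarith
    ultimately have qk: "Suc (4 * q) < 4 * k - 1" and "lev x = 4 * q + lev x mod 4" by simp_all
    then consider "lev x = 4 * q" | "lev x = Suc (4 * q)" | "lev x = Suc (Suc (4 * q))"
      | "lev x = Suc (Suc (Suc (4 * q)))" using mod_less_divisor[of 4 "lev x"] by linarith
    then show ?thesis
    proof cases
      case 4
      then have "Suc (lev x) = 4 * Suc q" by simp
      moreover have "Suc q < k" using 4 xl by linarith
      ultimately show ?thesis using 4 by (simp add: l_def mod_Suc)
    qed (use xl qk in \<open>auto simp: l_def mod_Suc\<close>)
  qed
  have nb: "{x, vtx l i} \<in> edges G" if "i < n" for i
  proof -
    have "{x, vtx l i} \<in> edges (ring_graph k n N)"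
      unfolding ring_edge_iff using x xl l that
      by (auto simp: ring_verts_iff level_size_def ring_step_def)
    then show ?thesis using sub by blast
  qed
  have "inj_on (\<lambda>i. {x, vtx l i}) {..<n}" by (auto simp: inj_on_def doubleton_eq_iff)
  then have "n = card ((\<lambda>i. {x, vtx l i}) ` {..<n})" by (simp add: card_image)
  also have "\<dots> \<le> card {e \<in> edges G. x \<in> e}"
  proof (rule card_mono)
    have "edges G \<subseteq> Pow (verts G)" "finite (verts G)" using G by (auto simp: simple_graph_def)
    then have "finite (edges G)" by (metis finite_Pow_iff finite_subset)
    then show "finite {e \<in> edges G. x \<in> e}" by simp
  qed (use nb in auto)
  finally show ?thesis by (simp add: degree_def)
qed

section \<open>The ring contains no blowup of the odd cycle\<close>

text \<open>The adjacency of the ring with unboundedly many vertices on each level.  The sizes of the levels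
  play no role in the proof that there is no copy.\<close>
definition ring_adj :: "nat \<Rightarrow> nat \<Rightarrow> nat \<Rightarrow> bool" where
  "ring_adj k x y \<longleftrightarrow> lev x < 4 * k - 1 \<and> lev y < 4 * k - 1 \<and> (ring_step k x y \<or> ring_step k y x)"

text \<open>The levels of \<open>x\<close> and \<open>y\<close> are consecutive integers in the same block.  The blocks are the levels
  \<open>0, 1, 2\<close> and then \<open>4 * j - 1, \<dots>, 4 * j + 2\<close> for \<open>j \<ge> 1\<close>; these are the components that remain when
  the links are removed.\<close>
definition block_adj :: "nat \<Rightarrow> nat \<Rightarrow> bool" where
  "block_adj x y \<longleftrightarrow> (lev y = Suc (lev x) \<or> lev x = Suc (lev y)) \<and> Suc (lev x) div 4 = Suc (lev y) div 4"

lemma ring_adj_cases: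
  assumes "ring_adj k x y" "k \<ge> 2"
  shows "block_adj x y \<or> lev x mod 4 = 2 \<and> ring_step k x y \<or> lev y mod 4 = 2 \<and> ring_step k y x"
proof -
  have *: "block_adj x y" if "ring_step k x y" "lev x < 4 * k - 1" "lev x mod 4 \<noteq> 2" for x y
  proof -
    have "Suc (lev x) < 4 * k - 1" using that assms by presburger
    then have "lev y = Suc (lev x)" using that by (simp add: ring_step_def)
    then show ?thesis using that(3) unfolding block_adj_def by presburger
  qed
  have "block_adj x y" if "block_adj y x" using that by (auto simp: block_adj_def)
  then show ?thesis
    using assms(1) *[of x y] *[of y x] unfolding ring_adj_def by blast
qed

text \<open>A link lies in no four-cycle.  If the link \<open>x y\<close> did, then, each end of a link having only one
  partner across it, the walk \<open>t x y z\<close> would climb three levels; but \<open>t\<close> and \<open>z\<close> are on cyclically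
  consecutive levels of a ring with at least seven levels.\<close>
lemma ring_square_aux:
  assumes k: "k \<ge> 2" and link: "lev x mod 4 = 2" "ring_step k x y"
    and adj: "ring_adj k x y" "ring_adj k y z" "ring_adj k z t" "ring_adj k t x"
  shows "x = z \<or> y = t"
proof (rule ccontr)
  assume ne: "\<not> (x = z \<or> y = t)"
  let ?M = "4 * k - 1"
  have lt: "lev x < ?M" "lev y < ?M" "lev z < ?M" "lev t < ?M" using adj by (auto simp: ring_adj_def)
  have y: "lev y = Suc (lev x) mod ?M" "idx x = idx y" using link by (auto simp: ring_step_def)
  have z: "\<not> ring_step k z y"
  proof
    assume s: "ring_step k z y"
    then have "lev z = lev x"
      using y(1) lt k by (auto simp: ring_step_def mod_if split: if_splits)
    moreover from this have "idx z = idx x" using s link y by (simp add: ring_step_def)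
    ultimately show False using ne vtx_eqI by metis
  qed
  then have z: "lev z = Suc (lev y) mod ?M" using adj by (auto simp: ring_adj_def ring_step_def)
  have t: "\<not> ring_step k x t"
    using ne link y by (auto simp: ring_step_def intro: vtx_eqI)
  then have t: "lev x = Suc (lev t) mod ?M" using adj by (auto simp: ring_adj_def ring_step_def)
  have zt: "lev t = Suc (lev z) mod ?M \<or> lev z = Suc (lev t) mod ?M"
    using adj by (auto simp: ring_adj_def ring_step_def)
  have next_level: "b = Suc a \<and> Suc a < ?M \<or> b = 0 \<and> Suc a = ?M" if "b = Suc a mod ?M" "a < ?M" for a b
    using that by (cases "Suc a = ?M") auto
  show False
    using zt k next_level[OF y(1) lt(1)] next_level[OF z lt(2)] next_level[OF t lt(4)]
      next_level[OF _ lt(3), of "lev t"] next_level[OF _ lt(4), of "lev z"]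
    by (elim disjE) linarith+
qed

lemma ring_square:
  assumes k: "k \<ge> 2" and "x \<noteq> z" "y \<noteq> t"
    and adj: "ring_adj k x y" "ring_adj k y z" "ring_adj k z t" "ring_adj k t x"
  shows "block_adj x y"
proof -
  have "ring_adj k b a" if "ring_adj k a b" for a b using that by (auto simp: ring_adj_def)
  note sym = adj[THEN this]
  show ?thesis
    using ring_adj_cases[OF adj(1) k] ring_square_aux[OF k _ _ adj]
      ring_square_aux[OF k _ _ sym(1) sym(4) sym(3) sym(2)] assms(2,3) by blast
qed

lemma block_walk:
  assumes "\<And>i. i < d \<Longrightarrow> block_adj (v i) (v (Suc i))"
  shows "Suc (lev (v d)) div 4 = Suc (lev (v 0)) div 4 \<and> (even (lev (v d) + lev (v 0)) \<longleftrightarrow> even d)"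
  using assms
proof (induction d)
  case (Suc d)
  then have "block_adj (v d) (v (Suc d))"
    and "Suc (lev (v d)) div 4 = Suc (lev (v 0)) div 4 \<and> (even (lev (v d) + lev (v 0)) \<longleftrightarrow> even d)"
    by simp_all
  then show ?case unfolding block_adj_def by auto
qed simp

lemma same_block_distance:
  fixes a b :: nat
  assumes "Suc a div 4 = Suc b div 4" "even (a + b)"
  shows "\<bar>int a - int b\<bar> \<le> 2" "even (int a - int b)"
proof -
  show ev: "even (int a - int b)" using assms(2) by simp
  have "\<bar>int a - int b\<bar> < 4" using assms(1) by linarith
  moreover obtain c where "int a - int b = 2 * c" using ev by (elim evenE)
  ultimately show "\<bar>int a - int b\<bar> \<le> 2" by presburger
qed

text \<open>\<open>S\<close> is the displacement of the walk, each step counting as \<open>1\<close> or \<open>-1\<close> according to its direction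
  around the ring.\<close>
lemma ring_walk:
  assumes "\<And>i. i < d \<Longrightarrow> ring_adj k (v i) (v (Suc i))"
  shows "\<exists>S :: int. \<bar>S\<bar> \<le> int d \<and> (even S \<longleftrightarrow> even d) \<and>
           int (4 * k - 1) dvd int (lev (v d)) - int (lev (v 0)) - S"
  using assms
proof (induction d)
  case 0
  then show ?case by (intro exI[of _ 0]) auto
next
  case (Suc d)
  then obtain S :: int where S: "\<bar>S\<bar> \<le> int d" "even S \<longleftrightarrow> even d"
    "int (4 * k - 1) dvd int (lev (v d)) - int (lev (v 0)) - S" by (auto simp: less_Suc_eq)
  have st: "int (4 * k - 1) dvd int (lev y) - int (lev x) - 1" if "ring_step k x y" for x y
  proof -
    have "int (lev y) = (int (lev x) + 1) mod int (4 * k - 1)"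
      using that by (simp add: ring_step_def zmod_int add.commute)
    then show ?thesis
      by (metis diff_diff_eq dvd_minus_mod dvd_minus_iff minus_diff_eq)
  qed
  have "ring_step k (v d) (v (Suc d)) \<or> ring_step k (v (Suc d)) (v d)"
    using Suc.prems[of d] by (simp add: ring_adj_def)
  then show ?case
  proof
    assume "ring_step k (v d) (v (Suc d))"
    from dvd_add[OF st[OF this] S(3)] show ?case
      using S(1,2) by (intro exI[of _ "S + 1"]) (auto simp: algebra_simps)
  next
    assume "ring_step k (v (Suc d)) (v d)"
    from dvd_diff[OF S(3) st[OF this]] show ?case
      using S(1,2) by (intro exI[of _ "S - 1"]) (auto simp: algebra_simps)
  qed
qed

lemma ring_graph_free:
  assumes k: "k \<ge> 2" and s: "s \<ge> 2 * k"
    and bl: "blowup_with (cycle_graph (2 * s - 1)) Q H"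
    and thin: "\<And>j. j < 4 * k - 4 \<Longrightarrow> card (Q j) = 1"
    and thick: "\<And>j. 4 * k - 4 \<le> j \<Longrightarrow> j < 2 * s - 1 \<Longrightarrow> card (Q j) \<ge> 2"
  shows "\<not> contains_copy (ring_graph k n N) H"
proof
  define m where "m = 2 * s - 1"
  define l where "l = 4 * k - 4"
  have ml: "l \<ge> 4" "l + 3 \<le> m" using k s by (auto simp: m_def l_def)
  assume "contains_copy (ring_graph k n N) H"
  then obtain f where f: "inj_on f (verts H)" "f ` verts H \<subseteq> verts (ring_graph k n N)"
    "\<forall>e\<in>edges H. f ` e \<in> edges (ring_graph k n N)" by (rule contains_copyE)
  have V: "verts H = (\<Union>j<m. Q j)" and dj: "disjoint_family_on Q {..<m}"
    and E: "edges H = {{u, v} | u v x y. {x, y} \<in> edges (cycle_graph m) \<and> u \<in> Q x \<and> v \<in> Q y}"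
    using bl by (auto simp: blowup_with_def cycle_graph_def m_def)
  have adj: "ring_adj k (f u) (f w)" if "j < m" "u \<in> Q j" "w \<in> Q (Suc j mod m)" for j u w
  proof -
    have "{j, Suc j mod m} \<in> edges (cycle_graph m)" using that by (auto simp: cycle_graph_def)
    then have "{u, w} \<in> edges H" unfolding E using that by blast
    from bspec[OF f(3) this] show ?thesis by (auto simp: ring_edge_iff ring_verts_iff ring_adj_def)
  qed
  have ne: "Q j \<noteq> {}" if "j < m" for j
    using thin[of j] thick[of j] that by (cases "j < l") (auto simp: m_def l_def)
  have neq: "f u \<noteq> f w" if "i < m" "j < m" "u \<in> Q i" "w \<in> Q j" "u \<noteq> w" for i j u w
    using f(1) that V by (auto simp: inj_on_def)
  \<comment> \<open>\<open>v\<close> runs periodically around the copy of a cycle of length \<open>m\<close> with one vertex in each part.\<close>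
  define q where "q j = (SOME u. u \<in> Q (j mod m))" for j
  have q: "q j \<in> Q (j mod m)" for j
  proof -
    have "\<exists>u. u \<in> Q (j mod m)" using ne[of "j mod m"] ml by auto
    then show ?thesis unfolding q_def by (rule someI_ex)
  qed
  define v where "v j = f (q j)" for j
  have adjv: "ring_adj k (v j) (v (Suc j))" for j
    unfolding v_def using adj[of "j mod m" "q j" "q (Suc j)"] q[of j] q[of "Suc j"] ml
    by (simp add: mod_simps)
  have sym: "ring_adj k b a" if "ring_adj k a b" for a b using that by (auto simp: ring_adj_def)
  \<comment> \<open>A second vertex \<open>q'\<close> in a large part completes both edges of the cycle there to a four-cycle.\<close>
  have blk: "block_adj (v j) (v (Suc j)) \<and> block_adj (v (Suc j)) (v (Suc (Suc j)))"
    if j: "l \<le> Suc j" "Suc j < m" for j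
  proof -
    obtain q' where q': "q' \<in> Q (Suc j)" "q' \<noteq> q (Suc j)"
    proof -
      have "\<not> Q (Suc j) \<subseteq> {q (Suc j)}"
        using thick[of "Suc j"] j card_mono[of "{q (Suc j)}" "Q (Suc j)"] by (auto simp: l_def m_def)
      then show ?thesis using that by blast
    qed
    have 1: "ring_adj k (v j) (f q')"
      unfolding v_def using adj[of j "q j" q'] q[of j] q' j by simp
    have 2: "ring_adj k (f q') (v (Suc (Suc j)))"
      unfolding v_def using adj[of "Suc j" q' "q (Suc (Suc j))"] q[of "Suc (Suc j)"] q' j by simp
    have 3: "v (Suc j) \<noteq> f q'" 
      unfolding v_def using neq[of "Suc j" "Suc j"] q[of "Suc j"] q' j by simp
    have "j mod m \<noteq> Suc (Suc j) mod m"
      using j ml by (cases "Suc (Suc j) = m") auto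
    then have "q j \<noteq> q (Suc (Suc j))"
      using q[of j] q[of "Suc (Suc j)"] ml
        disjoint_family_onD[OF dj, of "j mod m" "Suc (Suc j) mod m"] by auto
    then have 4: "v j \<noteq> v (Suc (Suc j))"
      unfolding v_def using neq[of "j mod m" "Suc (Suc j) mod m"] q[of j] q[of "Suc (Suc j)"] ml by simp
    show ?thesis
      using ring_square[OF k 4 3 adjv adjv 2[THEN sym] 1[THEN sym]]
        ring_square[OF k 3 4[symmetric] adjv 2[THEN sym] 1[THEN sym] adjv] by simp
  qed
  \<comment> \<open>Follow the large parts from the last singleton \<open>v (l - 1)\<close> to the first one, \<open>v m = v 0\<close>.\<close>
  have "block_adj (v (l - 1 + i)) (v (Suc (l - 1 + i)))" if "i < m - (l - 1)" for i
  proof (cases "l - 1 + i < m - 1")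
    case True
    then show ?thesis using blk[of "l - 1 + i"] ml by auto
  next
    case False
    then have "l - 1 + i = Suc (m - 2)" using that ml by auto
    then show ?thesis using blk[of "m - 2"] ml by simp
  qed
  from block_walk[of "m - (l - 1)" "\<lambda>i. v (l - 1 + i)"] this
  have bw: "Suc (lev (v m)) div 4 = Suc (lev (v (l - 1))) div 4"
    "even (lev (v m) + lev (v (l - 1))) \<longleftrightarrow> even (m - (l - 1))"
    using ml by auto
  have "even (m - (l - 1))" using k s by (auto simp: m_def l_def)
  moreover have "v m = v 0" by (simp add: v_def q_def)
  ultimately have D: "\<bar>int (lev (v (l - 1))) - int (lev (v 0))\<bar> \<le> 2"
      "even (int (lev (v (l - 1))) - int (lev (v 0)))"
    using same_block_distance[of "lev (v (l - 1))" "lev (v 0)"] bw by (simp_all add: add.commute)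
  \<comment> \<open>The way back through the singletons has \<open>l - 1 = 4 * k - 5\<close> edges.\<close>
  obtain S :: int where S: "\<bar>S\<bar> \<le> int (l - 1)" "even S \<longleftrightarrow> even (l - 1)"
    "int (4 * k - 1) dvd int (lev (v (l - 1))) - int (lev (v 0)) - S"
    using ring_walk[of "l - 1" k v, OF adjv] by blast
  have "\<bar>int (lev (v (l - 1))) - int (lev (v 0)) - S\<bar> < int (4 * k - 1)"
  proof -
    have "int (l - 1) + 4 = int (4 * k - 1)" using k by (simp add: l_def)
    then show ?thesis using S(1) D(1) by linarith
  qed
  then have "int (lev (v (l - 1))) - int (lev (v 0)) = S"
    using S(3) zdvd_not_zless[of "\<bar>int (lev (v (l - 1))) - int (lev (v 0)) - S\<bar>"] by fastforce
  moreover have "odd (l - 1)" using ml by (simp add: l_def)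
  ultimately show False using D(2) S(2) by simp
qed

section \<open>Completing the matching creates the blowup\<close>

text \<open>Position \<open>4 * k - 4\<close> of the cycle goes to level \<open>2\<close>.  The number of large parts is odd, so the
  alternation between levels \<open>3\<close> and \<open>4\<close> ends on level \<open>4\<close>, next to level \<open>5\<close> of the first singleton.\<close>
lemma copy_if_matching_completed:
  assumes k: "k \<ge> 2" and s: "s \<ge> 2 * k"
    and H: "simple_graph H" and bl: "blowup_with (cycle_graph (2 * s - 1)) Q H"
    and thin: "\<And>j. j < 4 * k - 4 \<Longrightarrow> card (Q j) = 1"
    and V: "verts G = verts (ring_graph k n N)" and E: "edges (ring_graph k n N) \<subseteq> edges G"
    and I: "I \<subseteq> {..<N}" "card (verts H) \<le> card I" and N: "0 < N" "N \<le> n"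
    and complete: "\<And>i j. i \<in> I \<Longrightarrow> j \<in> I \<Longrightarrow> {vtx 2 i, vtx 3 j} \<in> edges G"
  shows "contains_copy G H"
proof -
  define m where "m = 2 * s - 1"
  define l where "l = 4 * k - 4"
  have ml: "l \<ge> 4" "l + 3 \<le> m" "even l" "odd m" using k s by (auto simp: m_def l_def)
  have M: "4 * k - 1 = l + 3" "4 * k - Suc 0 = l + 3" using k by (simp_all add: l_def)
  have VH: "verts H = (\<Union>j<m. Q j)" and dj: "disjoint_family_on Q {..<m}"
    and EH: "edges H = {{u, v} | u v x y. {x, y} \<in> edges (cycle_graph m) \<and> u \<in> Q x \<and> v \<in> Q y}"
    using bl by (auto simp: blowup_with_def cycle_graph_def m_def)
  have "finite (verts H)" "finite I" using H I finite_subset by (auto simp: simple_graph_def)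
  then obtain g where g: "g ` verts H \<subseteq> I" "inj_on g (verts H)"
    using card_le_inj[OF _ _ I(2)] by blast
  define pos where "pos h = (THE j. j < m \<and> h \<in> Q j)" for h
  have pos: "pos h = j" if "j < m" "h \<in> Q j" for h j
    unfolding pos_def using that dj by (intro the_equality) (auto simp: disjoint_family_on_def)
  have posV: "pos h < m" "h \<in> Q (pos h)" if "h \<in> verts H" for h
    using that pos VH by auto
  \<comment> \<open>\<open>L j\<close> is the level of the \<open>j\<close>-th part.  Vertices in large parts are told apart by their index \<open>g\<close>,
    since several parts share the levels \<open>3\<close> and \<open>4\<close>.\<close>
  define L where "L j = (if j < l then (5 + j) mod (l + 3) else if j = l then 2
    else if odd j then 3 else 4)" for j
  have L: "L j = (if j < l then if j < l - 2 then 5 + j else j - (l - 2) else if j = l then 2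
    else if odd j then 3 else 4)" for j
    using ml unfolding L_def by (auto simp: mod_if)
  define f where "f h = vtx (L (pos h)) (if pos h < l then 0 else g h)" for h
  have Llt: "L j < l + 3" for j using ml by (auto simp: L)
  have fV: "f h \<in> verts G" if "h \<in> verts H" for h
  proof -
    have "g h < N" using g I that by auto
    then show ?thesis unfolding V ring_verts_iff M
      using Llt N by (auto simp: f_def level_size_def)
  qed
  have inj: "inj_on f (verts H)"
  proof (rule inj_onI)
    fix h h' assume h: "h \<in> verts H" "h' \<in> verts H" "f h = f h'"
    then have LL: "L (pos h) = L (pos h')"
      and gg: "(if pos h < l then 0 else g h) = (if pos h' < l then 0 else g h')"
      by (auto simp: f_def)
    show "h = h'"
    proof (cases "pos h < l")
      case True
      then have "pos h = pos h'" using LL ml by (auto simp: L split: if_splits)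
      then show ?thesis
        using posV[OF h(1)] posV[OF h(2)] thin[of "pos h"] True by (auto simp: card_1_singleton_iff l_def)
    next
      case False
      then have "\<not> pos h' < l" using LL ml by (auto simp: L split: if_splits)
      then show ?thesis using False gg g(2) h by (auto simp: inj_on_def)
    qed
  qed
  have edge: "{f u, f w} \<in> edges G" if uw: "j < m" "u \<in> Q j" "w \<in> Q (Suc j mod m)" for j u w
  proof -
    have pu: "pos u = j" and pw: "pos w = Suc j mod m" using pos uw ml by auto
    have uwV: "u \<in> verts H" "w \<in> verts H" unfolding VH using uw ml by force+
    have step: ?thesis if "ring_step k (f u) (f w) \<or> ring_step k (f w) (f u)"
      using that fV[OF uwV(1)] fV[OF uwV(2)] V E by (auto simp: ring_edge_iff)
    consider "Suc j < l" | "Suc j = l" | "j = l" | "l < j" "odd j" | "l < j" "even j" "Suc j < m"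
      | "Suc j = m" using uw(1) by linarith
    then show ?thesis
    proof cases
      case 1
      then have "ring_step k (f u) (f w)"
        using ml by (simp add: ring_step_def f_def pu pw M L_def mod_simps)
      then show ?thesis using step by blast
    next
      case 2
      then have "L j = 1" "L (Suc j) = 2" using ml by (auto simp: L)
      then have "ring_step k (f u) (f w)"
        using ml 2 by (simp add: ring_step_def f_def pu pw M)
      then show ?thesis using step by blast
    next
      case 3
      have "g u \<in> I" "g w \<in> I" using g uwV by auto
      then show ?thesis using complete 3 ml by (simp add: f_def pu pw L)
    next
      case 4
      then have "Suc j < m" using uw(1) ml by (metis Suc_lessI even_Suc)
      then have "ring_step k (f u) (f w)"
        using 4 ml by (simp add: ring_step_def f_def pu pw M L)
      then show ?thesis using step by blast
    next
      case 5
      then have "ring_step k (f w) (f u)"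
        using ml by (simp add: ring_step_def f_def pu pw M L)
      then show ?thesis using step by blast
    next
      case 6
      then have "even j" "l < j" using ml by auto
      then have "ring_step k (f u) (f w)"
        using 6 ml by (simp add: ring_step_def f_def pu pw M L)
      then show ?thesis using step by blast
    qed
  qed
  show ?thesis
  proof (rule contains_copyI[OF H inj])
    fix e assume "e \<in> edges H"
    then obtain u w x y where e: "e = {u, w}" "{x, y} \<in> edges (cycle_graph m)" "u \<in> Q x" "w \<in> Q y"
      unfolding EH by blast
    then obtain j where j: "j < m" "{x, y} = {j, Suc j mod m}" by (auto simp: cycle_graph_def)
    then have "x = j \<and> y = Suc j mod m \<or> x = Suc j mod m \<and> y = j" by (auto simp: doubleton_eq_iff)
    then show "f ` e \<in> edges G"
      using edge[OF j(1), of u w] edge[OF j(1), of w u] e by (auto simp: insert_commute)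
  qed (use fV in auto)
qed

section \<open>The lower bound\<close>

lemma not_blowup_admissible:
  fixes H :: "'a ugraph"
  assumes k: "k \<ge> 2" and s: "s \<ge> 2 * k" and H: "H \<in> cycle_blowups (2 * s - 1) (4 * k - 4)"
    and \<alpha>: "0 \<le> \<alpha>" "\<alpha> < 1 / (2 * real k)"
  shows "\<not> blowup_admissible H \<alpha>"
proof
  assume "blowup_admissible H \<alpha>"
  then obtain F :: "nat ugraph" where F: "simple_graph F"
    and adm: "\<And>G :: nat ugraph. maximal_free H G \<Longrightarrow>
      real (min_degree G) \<ge> \<alpha> * real (card (verts G)) \<Longrightarrow> is_blowup F G"
    unfolding blowup_admissible_def by blast
  obtain P a where sH: "simple_graph H" and P: "blowup_with (cycle_graph (2 * s - 1)) P H"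
    and thin: "\<forall>j<4 * k - 4. card (P ((a + j) mod (2 * s - 1))) = 1"
    and thick: "\<forall>j. 4 * k - 4 \<le> j \<and> j < 2 * s - 1 \<longrightarrow> card (P ((a + j) mod (2 * s - 1))) \<ge> 2"
    using H unfolding cycle_blowups_def by blast
  define Q where "Q j = P ((a + j) mod (2 * s - 1))" for j
  have Q: "blowup_with (cycle_graph (2 * s - 1)) Q H"
    unfolding Q_def using P k s by (intro cycle_blowup_rotate) auto
  define N where "N = Suc (card (verts F) * card (verts H))"
  \<comment> \<open>\<open>n\<close> is chosen so large that \<open>\<alpha> * (2 * k * (n + N)) \<le> n\<close>.\<close>
  define r where "r = 1 - \<alpha> * (2 * real k)"
  have r: "r > 0" using \<alpha> k by (simp add: r_def field_simps)
  define n where "n = N + nat \<lceil>\<alpha> * (2 * real k) * real N / r\<rceil>"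
  have "\<alpha> * (2 * real k) * real N / r \<le> real n" unfolding n_def by linarith
  then have "\<alpha> * (2 * real k) * real N \<le> real n * r" using r by (simp add: pos_divide_le_eq)
  then have nN: "\<alpha> * (2 * real k * (real n + real N)) \<le> real n"
    by (simp add: r_def algebra_simps)
  let ?R = "ring_graph k n N"
  have "\<not> contains_copy ?R H"
    by (rule ring_graph_free[OF k s Q]) (use thin thick in \<open>auto simp: Q_def\<close>)
  then obtain G where G: "maximal_free H G" "verts G = verts ?R" "edges ?R \<subseteq> edges G"
    using maximal_free_supergraph[OF simple_ring_graph[OF k]] by metis
  have sG: "simple_graph G" using G(1) by (simp add: maximal_free_def)
  have vG: "vtx l i \<in> verts G" if "l < 4 * k - 1" "i < N" for l i
    using that by (simp add: G(2) ring_verts_iff level_size_def n_def)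
  have "n \<le> min_degree G"
    using degree_ring_graph[OF k _ sG G(3)] vG[of 0 0] k finite_ring_verts[of k n N]
    by (auto simp: min_degree_def G(2) N_def)
  moreover have "\<alpha> * real (card (verts G)) \<le> \<alpha> * (2 * real k * (real n + real N))"
  proof (rule mult_left_mono[OF _ \<alpha>(1)])
    have "real (card (verts G)) \<le> real (2 * k * (n + N))"
      unfolding G(2) by (rule of_nat_mono[OF card_ring_verts])
    then show "real (card (verts G)) \<le> 2 * real k * (real n + real N)" by simp
  qed
  ultimately have "real (min_degree G) \<ge> \<alpha> * real (card (verts G))" using nN by linarith
  then obtain B where B: "blowup_with F B G" using adm G(1) by (auto simp: is_blowup_def)
  \<comment> \<open>Some part contains as many vertices of level \<open>2\<close> as \<open>H\<close> has vertices.\<close>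
  obtain x where x: "x \<in> verts F" "card (verts H) \<le> card {i. i < N \<and> vtx 2 i \<in> B x}"
  proof (rule ccontr)
    assume "\<not> thesis"
    then have small: "card {i. i < N \<and> vtx 2 i \<in> B x} \<le> card (verts H)" if "x \<in> verts F" for x
      using that \<open>\<And>x. x \<in> verts F \<Longrightarrow> _ \<Longrightarrow> thesis\<close> by force
    have "{..<N} \<subseteq> (\<Union>x\<in>verts F. {i. i < N \<and> vtx 2 i \<in> B x})"
      using vG[of 2] k B by (auto simp: blowup_with_def)
    then have "N \<le> card (\<Union>x\<in>verts F. {i. i < N \<and> vtx 2 i \<in> B x})"
      using F card_mono[of _ "{..<N}"] by (fastforce simp: simple_graph_def)
    also have "\<dots> \<le> (\<Sum>x\<in>verts F. card {i. i < N \<and> vtx 2 i \<in> B x})"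
      using F by (intro card_UN_le) (simp add: simple_graph_def)
    also have "\<dots> \<le> card (verts F) * card (verts H)"
      using sum_bounded_above[of "verts F" "\<lambda>x. card {i. i < N \<and> vtx 2 i \<in> B x}", OF small] by simp
    finally show False by (simp add: N_def)
  qed
  let ?I = "{i. i < N \<and> vtx 2 i \<in> B x}"
  have "{vtx 2 i, vtx 3 j} \<in> edges G" if "i \<in> ?I" "j \<in> ?I" for i j
  proof -
    have "{vtx 2 j, vtx 3 j} \<in> edges ?R"
      unfolding ring_edge_iff using vG[of 2 j] vG[of 3 j] that k
      by (auto simp: G(2) ring_step_def)
    then show ?thesis using blowup_twins[OF B x(1) F] that G(3) by blast
  qed
  then have "contains_copy G H"
    by (intro copy_if_matching_completed[OF k s sH Q _ G(2,3) _ x(2)])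
      (use thin in \<open>auto simp: Q_def N_def n_def\<close>)
  then show False using G(1) by (simp add: maximal_free_def)
qed

theorem theorem1p5:
  fixes s k :: nat and H :: "'a ugraph"
  assumes "s \<ge> 2 * k" and "2 * k \<ge> 4"
    and "H \<in> cycle_blowups (2 * s - 1) (4 * k - 4)"
  shows "blowup_threshold H \<ge> 1 / (2 * real k)"
  unfolding blowup_threshold_def
proof (rule cInf_greatest)
  show "{\<alpha>. 0 \<le> \<alpha> \<and> blowup_admissible H \<alpha>} \<noteq> {}"
    using blowup_admissible_one[of H] by (auto intro!: exI[of _ 1])
  fix \<alpha> assume "\<alpha> \<in> {\<alpha>. 0 \<le> \<alpha> \<and> blowup_admissible H \<alpha>}"
  then show "1 / (2 * real k) \<le> \<alpha>"
    using not_blowup_admissible[of k s H \<alpha>] assms by force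
qed

end
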